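(* Let $n\ge 2$ be fixed. The probability that the characteristic polynomial of a uniformly random matrix $M\in\mathrm{SL}(n,\mathbb{F}_p)$ has a proper monic factor over $\mathbb{F}_p$ (i.e. a monic factor of degree $m$ with $1\le m\le n-1$) with constant term $1$ is of order $O(1/p)$ as $p$ ranges over the primes (with implied constant independent of $p$).
   Context: $\mathbb{F}_p=\mathbb{Z}/p\mathbb{Z}$ is the field with $p$ elements. *)

theory Defs
  imports
    "HOL-Probability.Probability_Mass_Function"
    "Jordan_Normal_Form.Char_Poly"
    "Berlekamp_Zassenhaus.Poly_Mod"
begin

text \<open>
  The prime \<open>p\<close> is a variable of the statement, so \<open>\<int>/p\<int>\<close> cannot be a type. Elements of
  \<open>\<int>/p\<int>\<close> are represented by their canonical representatives in \<open>{0..<p}\<close>, matrices and polynomials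
  over it by integer matrices and integer polynomials with entries and coefficients in \<open>{0..<p}\<close>.
  Determinants, characteristic polynomials and products of polynomials commute with reduction
  modulo \<open>p\<close>, so they are computed over the integers and then reduced.
\<close>

definition Fp_mats :: "nat \<Rightarrow> int \<Rightarrow> int mat set" where
  "Fp_mats n p = {A \<in> carrier_mat n n. elements_mat A \<subseteq> {0..<p}}"

definition Fp_polys :: "int \<Rightarrow> int poly set" where
  "Fp_polys p = {f. range (coeff f) \<subseteq> {0..<p}}"

definition SL :: "nat \<Rightarrow> int \<Rightarrow> int mat set" where
  "SL n p = {A \<in> Fp_mats n p. Determinant.det A mod p = 1 mod p}"

definition Fp_char_poly :: "int \<Rightarrow> int mat \<Rightarrow> int poly" where
  "Fp_char_poly p A = poly_mod.Mp p (char_poly A)"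

text \<open>
  \<open>poly_mod.dvdm p\<close> is divisibility in the polynomial ring over \<open>\<int>/p\<int>\<close>. An element \<open>f\<close> of
  \<^term>\<open>Fp_polys p\<close> has the same degree, leading coefficient and constant term over \<open>\<int>\<close>
  as over \<open>\<int>/p\<int>\<close>.
\<close>

definition has_proper_factor_const_one :: "nat \<Rightarrow> int \<Rightarrow> int poly \<Rightarrow> bool" where
  "has_proper_factor_const_one n p g \<longleftrightarrow>
     (\<exists>f \<in> Fp_polys p. monic f \<and> 1 \<le> degree f \<and> degree f \<le> n - 1 \<and> coeff f 0 = 1 \<and>
        poly_mod.dvdm p f g)"

text \<open>\<^term>\<open>pmf_of_set\<close> is specified only for finite nonempty sets.\<close>

lemma finite_Fp_mats: "finite (Fp_mats n p)"
proof (rule finite_subset)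
  let ?F = "{f. \<forall>x. (x \<in> {..<n} \<times> {..<n} \<longrightarrow> f x \<in> {0..<p}) \<and> (x \<notin> {..<n} \<times> {..<n} \<longrightarrow> f x = 0)}"
  show "finite (mat n n ` ?F)"
    by (intro finite_imageI finite_set_of_finite_funs) auto
  show "Fp_mats n p \<subseteq> mat n n ` ?F"
  proof
    fix A assume A: "A \<in> Fp_mats n p"
    then have c: "A \<in> carrier_mat n n" and e: "elements_mat A \<subseteq> {0..<p}"
      by (auto simp: Fp_mats_def)
    define f where "f = (\<lambda>x. if x \<in> {..<n} \<times> {..<n} then A $$ x else 0)"
    have "A = mat n n f" using c by (auto simp: f_def)
    moreover have "f \<in> ?F" using c e by (fastforce simp: f_def elements_mat_def)
    ultimately show "A \<in> mat n n ` ?F" by blast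
  qed
qed

lemma finite_SL: "finite (SL n p)"
  by (rule finite_subset[OF _ finite_Fp_mats]) (auto simp: SL_def)

lemma SL_nonempty:
  assumes "p > 1"
  shows "SL n p \<noteq> {}"
proof -
  have "1\<^sub>m n \<in> SL n p" using assms by (auto simp: SL_def Fp_mats_def elements_mat_def)
  then show ?thesis by blast
qed

end

theory Submission
  imports Defs
begin

text \<open>
  The group \<open>SL\<close> has about \<open>p\<close> to the power \<open>n\<^sup>2 - 1\<close> elements, so the claim is that \<open>O(p\<^bsup>n\<^sup>2-2\<^esup>)\<close> of
  them have a characteristic polynomial with a proper factor of constant term \<open>1\<close>. The matrices
  are divided according to whether the first standard basis vector \<open>e\<^sub>0\<close> is a cyclic vector of \<open>A\<close>, that is, whether
  the Krylov matrix with columns \<open>e\<^sub>0, A e\<^sub>0, \<dots>, A\<^bsup>n-1\<^esup> e\<^sub>0\<close> is invertible modulo \<open>p\<close>.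

  If \<open>e\<^sub>0\<close> is cyclic, then \<open>A\<close> is determined by its Krylov matrix and its characteristic polynomial
  (\<open>Fp_mats_eq_if_krylov_char_poly_eq\<close>, by way of the Cayley-Hamilton theorem). There are at
  most \<open>p\<^bsup>n(n-1)\<^esup>\<close> Krylov matrices. The characteristic polynomials in question are products of two monic
  polynomials with prescribed constant terms, hence number at most \<open>n p\<^bsup>n-2\<^esup>\<close>
  (\<open>card_char_polys_with_factor\<close>). The product is \<open>n p\<^bsup>n\<^sup>2-2\<^esup>\<close>.

  If \<open>e\<^sub>0\<close> is not cyclic, the matrix satisfies
  the nontrivial polynomial equation that the Krylov matrix has determinant zero, and this alone costs
  a factor \<open>p\<close> (\<open>card_SL_noncyclic\<close>). The equation is counted in the affine space of all matrices, where
  lines through a point at which a polynomial does not vanish give a bound on the number of its zeros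
  (\<open>card_zeros_poly_on_lines\<close>). The passage between \<open>SL\<close> and all matrices is the bijection that
  scales the last row (\<open>SL_times_units\<close>). The same two tools, applied to the determinant, bound the order of \<open>SL\<close>
  from below (\<open>card_SL_lower\<close>).

  Since the prime is a variable, the field is represented by integers modulo \<open>p\<close>. Being polynomial along
  lines also serves here: it implies that a function of integer matrices respects
  congruence modulo \<open>p\<close> (\<open>poly_on_lines_cong\<close>).
\<close>

section \<open>Functions that are polynomial along lines\<close>

text \<open>
  A substitute for polynomials of total degree at most \<open>d\<close> in the \<open>n\<^sup>2\<close> entries of a matrix: all that
  the counting below needs from such a polynomial is its restriction to lines.
\<close>

definition poly_on_lines :: "nat \<Rightarrow> nat \<Rightarrow> (int mat \<Rightarrow> int) \<Rightarrow> bool" where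
  "poly_on_lines n d F \<longleftrightarrow> (\<forall>A\<in>carrier_mat n n. \<forall>U\<in>carrier_mat n n.
     \<exists>q. degree q \<le> d \<and> (\<forall>t. poly q t = F (A + t \<cdot>\<^sub>m U)))"

lemma poly_on_lines_mono:
  "poly_on_lines n d F \<Longrightarrow> d \<le> e \<Longrightarrow> poly_on_lines n e F"
  unfolding poly_on_lines_def using le_trans by blast

lemma poly_on_lines_const: "poly_on_lines n d (\<lambda>_. c)"
  unfolding poly_on_lines_def by (auto intro!: exI[of _ "[:c:]"])

lemma poly_on_lines_entry:
  assumes "i < n" "j < n"
  shows "poly_on_lines n 1 (\<lambda>A. A $$ (i,j))"
  unfolding poly_on_lines_def
proof (intro ballI)
  fix A U :: "int mat" assume "A \<in> carrier_mat n n" "U \<in> carrier_mat n n"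
  then show "\<exists>q. degree q \<le> 1 \<and> (\<forall>t. poly q t = (A + t \<cdot>\<^sub>m U) $$ (i, j))"
    using assms by (intro exI[of _ "[:A $$ (i,j), U $$ (i,j):]"]) auto
qed

lemma poly_on_lines_add:
  assumes "poly_on_lines n d F" "poly_on_lines n d G"
  shows "poly_on_lines n d (\<lambda>A. F A + G A)"
  unfolding poly_on_lines_def
proof (intro ballI)
  fix A U :: "int mat" assume AU: "A \<in> carrier_mat n n" "U \<in> carrier_mat n n"
  obtain q where q: "degree q \<le> d" "\<And>t. poly q t = F (A + t \<cdot>\<^sub>m U)"
    using assms(1) AU unfolding poly_on_lines_def by blast
  obtain r where r: "degree r \<le> d" "\<And>t. poly r t = G (A + t \<cdot>\<^sub>m U)"
    using assms(2) AU unfolding poly_on_lines_def by blast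
  show "\<exists>q. degree q \<le> d \<and> (\<forall>t. poly q t = F (A + t \<cdot>\<^sub>m U) + G (A + t \<cdot>\<^sub>m U))"
    using q r by (intro exI[of _ "q + r"]) (auto simp: degree_add_le)
qed

lemma poly_on_lines_mult:
  assumes "poly_on_lines n d F" "poly_on_lines n e G"
  shows "poly_on_lines n (d + e) (\<lambda>A. F A * G A)"
  unfolding poly_on_lines_def
proof (intro ballI)
  fix A U :: "int mat" assume AU: "A \<in> carrier_mat n n" "U \<in> carrier_mat n n"
  obtain q where q: "degree q \<le> d" "\<And>t. poly q t = F (A + t \<cdot>\<^sub>m U)"
    using assms(1) AU unfolding poly_on_lines_def by blast
  obtain r where r: "degree r \<le> e" "\<And>t. poly r t = G (A + t \<cdot>\<^sub>m U)"
    using assms(2) AU unfolding poly_on_lines_def by blast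
  have "degree (q * r) \<le> d + e"
    using q(1) r(1) degree_mult_le[of q r] by linarith
  then show "\<exists>q. degree q \<le> d + e \<and> (\<forall>t. poly q t = F (A + t \<cdot>\<^sub>m U) * G (A + t \<cdot>\<^sub>m U))"
    using q r by (intro exI[of _ "q * r"]) auto
qed

lemma poly_on_lines_sum:
  assumes "\<And>i. i \<in> I \<Longrightarrow> poly_on_lines n d (F i)"
  shows "poly_on_lines n d (\<lambda>A. \<Sum>i\<in>I. F i A)"
  using assms
  by (induction I rule: infinite_finite_induct)
    (auto intro: poly_on_lines_const poly_on_lines_add)

lemma poly_on_lines_prod:
  assumes "\<And>i. i \<in> I \<Longrightarrow> poly_on_lines n d (F i)"
  shows "poly_on_lines n (card I * d) (\<lambda>A. \<Prod>i\<in>I. F i A)"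
  using assms
  by (induction I rule: infinite_finite_induct)
    (auto intro: poly_on_lines_const poly_on_lines_mult)

lemma poly_on_lines_det:
  assumes "\<And>i j. i < n \<Longrightarrow> j < n \<Longrightarrow> poly_on_lines n d (F i j)"
  shows "poly_on_lines n (n * d) (\<lambda>A. Determinant.det (mat n n (\<lambda>(i,j). F i j A)))"
proof -
  have "poly_on_lines n (n * d)
    (\<lambda>A. \<Sum>\<pi>\<in>{\<pi>. \<pi> permutes {0..<n}}. signof \<pi> * (\<Prod>i=0..<n. F i (\<pi> i) A))"
  proof (rule poly_on_lines_sum)
    fix \<pi> assume "\<pi> \<in> {\<pi>. \<pi> permutes {0..<n}}"
    then have \<pi>: "\<And>i. i < n \<Longrightarrow> \<pi> i < n"
      by (metis atLeastLessThan_iff le0 mem_Collect_eq permutes_in_image)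
    have "poly_on_lines n (card {0..<n} * d) (\<lambda>A. \<Prod>i=0..<n. F i (\<pi> i) A)"
      by (rule poly_on_lines_prod) (auto intro: assms \<pi>)
    from poly_on_lines_mult[OF poly_on_lines_const[of n 0] this]
    show "poly_on_lines n (n * d) (\<lambda>A. signof \<pi> * (\<Prod>i=0..<n. F i (\<pi> i) A))"
      by simp
  qed
  moreover have "(\<Sum>\<pi>\<in>{\<pi>. \<pi> permutes {0..<n}}. signof \<pi> * (\<Prod>i=0..<n. F i (\<pi> i) A))
     = Determinant.det (mat n n (\<lambda>(i,j). F i j A))" for A
    by (subst det_def'[of _ n])
       (auto intro!: sum.cong prod.cong arg_cong2[of _ _ _ _ "(*)"] dest: permutes_in_image)
  ultimately show ?thesis by simp
qed

lemma poly_on_lines_cong_carrier: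
  assumes "poly_on_lines n d F" "\<And>A. A \<in> carrier_mat n n \<Longrightarrow> F A = G A"
  shows "poly_on_lines n d G"
  using assms unfolding poly_on_lines_def by simp

lemma mat_entries: "A \<in> carrier_mat n n \<Longrightarrow> mat n n (\<lambda>(i,j). A $$ (i,j)) = A"
  by (intro eq_matI) auto

lemma poly_on_lines_det_self: "poly_on_lines n n Determinant.det"
proof (rule poly_on_lines_cong_carrier)
  show "poly_on_lines n n (\<lambda>A. Determinant.det (mat n n (\<lambda>(i,j). A $$ (i,j))))"
    using poly_on_lines_det[of n 1 "\<lambda>i j A. A $$ (i,j)"] poly_on_lines_entry by simp
qed (simp only: mat_entries)

section \<open>Reduction modulo a prime\<close>

definition cong_mat :: "nat \<Rightarrow> int \<Rightarrow> int mat \<Rightarrow> int mat \<Rightarrow> bool" where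
  "cong_mat n p A B \<longleftrightarrow> (\<forall>i<n. \<forall>j<n. A $$ (i,j) mod p = B $$ (i,j) mod p)"

text \<open>
  Congruent matrices are \<open>B\<close> and \<open>B + p U\<close>, so they lie on one line, at the parameters \<open>0\<close> and \<open>p\<close>.
\<close>

lemma poly_on_lines_cong:
  assumes F: "poly_on_lines n d F"
    and A: "A \<in> carrier_mat n n" and B: "B \<in> carrier_mat n n" and "cong_mat n p A B"
  shows "F A mod p = F B mod p"
proof -
  define U where "U = mat n n (\<lambda>(i,j). (A $$ (i,j) - B $$ (i,j)) div p)"
  have U: "U \<in> carrier_mat n n" by (simp add: U_def)
  have AU: "A = B + p \<cdot>\<^sub>m U"
    using A B assms(4)
    by (intro eq_matI) (auto simp: U_def cong_mat_def mod_eq_dvd_iff)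
  have BU: "B = B + 0 \<cdot>\<^sub>m U"
    using B U by (intro eq_matI) auto
  obtain q where q: "\<And>t. poly q t = F (B + t \<cdot>\<^sub>m U)"
    using F B U unfolding poly_on_lines_def by blast
  have "poly q p mod p = poly q 0 mod p" by (cases q) simp
  then show ?thesis using q[of p] q[of 0] AU BU by simp
qed

text \<open>
  Splitting off one root \<open>b\<close> as \<open>q = (x - b) r + q(b)\<close> with \<open>p dvd q(b)\<close> leaves a polynomial of smaller
  degree which is again nonzero at \<open>a\<close>. Nonvanishing at a point is the form in which the hypothesis
  that \<open>q\<close> is nonzero modulo \<open>p\<close> is available later.
\<close>

lemma card_roots_mod_prime:
  fixes q :: "int poly"
  assumes p: "prime p" and "\<not> p dvd poly q a"
  shows "card {t \<in> {0..<p}. p dvd poly q t} \<le> degree q"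
  using assms(2)
proof (induction "degree q" arbitrary: q rule: less_induct)
  case less
  let ?R = "\<lambda>q. {t \<in> {0..<p}. p dvd poly q t}"
  show ?case
  proof (cases "?R q = {}")
    case True
    then show ?thesis by (simp only: card.empty)
  next
    case False
    then obtain b where b: "b \<in> {0..<p}" "p dvd poly q b" by blast
    define r where "r = synthetic_div q b"
    have q: "q + Polynomial.smult b r = pCons (poly q b) r"
      unfolding r_def by (rule synthetic_div_correct)
    have ev: "poly q t = (t - b) * poly r t + poly q b" for t
      using arg_cong[OF q, of "\<lambda>f. poly f t"] by (simp add: algebra_simps)
    have nz: "degree q \<noteq> 0"
    proof
      assume "degree q = 0"
      then obtain c where "q = [:c:]" by (rule degree_eq_zeroE)
      then show False using b less.prems by simp
    qed
    have dr: "degree r = degree q - 1" by (simp add: r_def degree_synthetic_div)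
    have "\<not> p dvd poly r a" using less.prems b(2) ev[of a] by (metis dvd_add dvd_mult)
    then have IH: "card (?R r) \<le> degree r" using less.hyps[of r] nz dr by simp
    have "?R q \<subseteq> insert b (?R r)"
    proof
      fix t assume t: "t \<in> ?R q"
      then have "p dvd (t - b) * poly r t" using ev[of t] b(2) by (simp add: dvd_add_left_iff)
      then have "p dvd t - b \<or> p dvd poly r t" using p by (simp add: prime_dvd_mult_iff)
      moreover have "t = b" if "p dvd t - b"
        using that t b(1) by (metis (no_types, lifting) atLeastLessThan_iff mem_Collect_eq mod_eq_dvd_iff mod_pos_pos_trivial)
      ultimately show "t \<in> insert b (?R r)" using t by auto
    qed
    moreover have "finite (?R r)" by (rule finite_subset[of _ "{0..<p}"]) auto
    ultimately have "card (?R q) \<le> card (insert b (?R r))" by (intro card_mono) auto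
    also have "\<dots> \<le> Suc (card (?R r))"
      using \<open>finite (?R r)\<close> card_insert_if[of "?R r" b] by (simp only: split: if_split) simp
    finally show ?thesis using IH nz dr by linarith
  qed
qed

section \<open>Krylov matrices and the Cayley-Hamilton theorem\<close>

text \<open>
  Vectors are functions on indices. They are cut off at \<open>n\<close>, so that equality of functions is equality
  of vectors.
\<close>

definition apply_mat :: "nat \<Rightarrow> 'a::comm_ring_1 mat \<Rightarrow> (nat \<Rightarrow> 'a) \<Rightarrow> nat \<Rightarrow> 'a" where
  "apply_mat n A v = (\<lambda>i. if i < n then \<Sum>k<n. A $$ (i,k) * v k else 0)"

definition krylov :: "nat \<Rightarrow> 'a::comm_ring_1 mat \<Rightarrow> nat \<Rightarrow> nat \<Rightarrow> 'a" where
  "krylov n A j = (apply_mat n A ^^ j) (\<lambda>i. if i = 0 then 1 else 0)"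

definition krylov_mat :: "nat \<Rightarrow> 'a::comm_ring_1 mat \<Rightarrow> 'a mat" where
  "krylov_mat n A = mat n n (\<lambda>(i,j). krylov n A j i)"

lemma krylov_mat_carrier [simp]: "krylov_mat n A \<in> carrier_mat n n"
  by (simp add: krylov_mat_def)

lemma krylov_0: "krylov n A 0 = (\<lambda>i. if i = 0 then 1 else 0)"
  by (simp add: krylov_def)

lemma krylov_Suc:
  "krylov n A (Suc j) i = (if i < n then \<Sum>k<n. A $$ (i,k) * krylov n A j k else 0)"
  by (simp add: krylov_def apply_mat_def)

lemma apply_mat_pow_linear:
  "(apply_mat n A ^^ m) (\<lambda>i. a * u i + b * v i)
     = (\<lambda>i. a * (apply_mat n A ^^ m) u i + b * (apply_mat n A ^^ m) v i)"
proof (induction m)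
  case (Suc m)
  have lin: "apply_mat n A (\<lambda>i. a * u i + b * v i)
    = (\<lambda>i. a * apply_mat n A u i + b * apply_mat n A v i)" for u v
    by (auto simp: apply_mat_def fun_eq_iff sum.distrib sum_distrib_left algebra_simps)
  show ?case by (simp add: Suc lin)
qed simp

text \<open>
  The Cayley-Hamilton theorem \<open>\<chi>(A) e\<^sub>0 = 0\<close>. Let \<open>w\<^sub>l\<close> be the coefficient of \<open>x\<^sup>l\<close> in the first column of
  the adjugate of \<open>x I - A\<close>. Comparing coefficients in \<open>(x I - A) adj(x I - A) = \<chi> I\<close> gives
  \<open>c\<^sub>l e\<^sub>0 = w\<^bsub>l-1\<^esub> - A w\<^sub>l\<close>, so the sum of the \<open>c\<^sub>l A\<^sup>l e\<^sub>0\<close> telescopes up to a term with \<open>w\<^sub>N\<close>, which is zero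
  for large \<open>N\<close>.
\<close>

lemma cayley_hamilton_krylov:
  fixes A :: "'a::comm_ring_1 mat"
  assumes A: "A \<in> carrier_mat n n" and n: "n > 0"
  shows "(\<Sum>l\<le>n. coeff (char_poly A) l * krylov n A l i) = 0"
proof -
  define B where "B = adj_mat (char_poly_matrix A)"
  have C: "char_poly_matrix A \<in> carrier_mat n n" using A by simp
  have B: "B \<in> carrier_mat n n" using adj_mat(1)[OF C] by (simp add: B_def)
  define ch where "ch = char_poly A"
  define w where "w l i = (if i < n then coeff (B $$ (i,0)) l else 0)" for l i
  define e where "e = (\<lambda>i::nat. if i = 0 then 1 else (0::'a))"
  let ?T = "apply_mat n A"
  have adj: "[:0,1:] * B $$ (i,0) - (\<Sum>k<n. Polynomial.smult (A $$ (i,k)) (B $$ (k,0)))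
      = (if i = 0 then ch else 0)" if i: "i < n" for i
  proof -
    have "(\<Sum>k<n. char_poly_matrix A $$ (i,k) * B $$ (k,0)) = (char_poly_matrix A * B) $$ (i,0)"
      using i n B C by (simp add: scalar_prod_def atLeast0LessThan)
    also have "char_poly_matrix A * B = ch \<cdot>\<^sub>m 1\<^sub>m n"
      using adj_mat(2)[OF C] by (simp add: B_def ch_def char_poly_def)
    also have "(ch \<cdot>\<^sub>m 1\<^sub>m n) $$ (i,0) = (if i = 0 then ch else 0)" using i n by simp
    also have "(\<Sum>k<n. char_poly_matrix A $$ (i,k) * B $$ (k,0))
      = (\<Sum>k<n. (if k = i then [:0,1:] * B $$ (k,0) else 0)
           - Polynomial.smult (A $$ (i,k)) (B $$ (k,0)))"
      using A i by (intro sum.cong) (auto simp: char_poly_matrix_def algebra_simps)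
    also have "\<dots> = [:0,1:] * B $$ (i,0) - (\<Sum>k<n. Polynomial.smult (A $$ (i,k)) (B $$ (k,0)))"
      using i by (simp add: sum_subtractf)
    finally show ?thesis .
  qed
  have w0: "(\<lambda>i. coeff ch 0 * e i) = (\<lambda>i. - ?T (w 0) i)"
  proof
    fix i
    show "coeff ch 0 * e i = - ?T (w 0) i"
      using arg_cong[OF adj[of i], of "\<lambda>f. coeff f 0"] n
      by (cases "i < n") (auto simp: e_def apply_mat_def w_def coeff_sum split: if_splits)
  qed
  have wSuc: "(\<lambda>i. coeff ch (Suc l) * e i) = (\<lambda>i. 1 * w l i + (-1) * ?T (w (Suc l)) i)" for l
  proof
    fix i
    show "coeff ch (Suc l) * e i = 1 * w l i + (-1) * ?T (w (Suc l)) i"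
      using arg_cong[OF adj[of i], of "\<lambda>f. coeff f (Suc l)"] n
      by (cases "i < n") (auto simp: e_def apply_mat_def w_def coeff_sum split: if_splits)
  qed
  have tele: "(\<Sum>l\<le>N. coeff ch l * krylov n A l i) = - (?T ^^ Suc N) (w N) i" for N i
  proof (induction N)
    case 0
    then show ?case using fun_cong[OF w0, of i] by (simp add: krylov_0 e_def)
  next
    case (Suc N)
    have "coeff ch (Suc N) * krylov n A (Suc N) i
       = (?T ^^ Suc N) (\<lambda>i. coeff ch (Suc N) * e i + 0 * e i) i"
      unfolding apply_mat_pow_linear by (simp add: krylov_def e_def)
    also have "(\<lambda>i. coeff ch (Suc N) * e i + 0 * e i)
       = (\<lambda>i. 1 * w N i + (-1) * ?T (w (Suc N)) i)"
      using wSuc[of N] by simp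
    also have "(?T ^^ Suc N) \<dots> i = (?T ^^ Suc N) (w N) i - (?T ^^ Suc (Suc N)) (w (Suc N)) i"
      unfolding apply_mat_pow_linear by (simp add: funpow_swap1)
    finally show ?case using Suc by simp
  qed
  define N where "N = n + Max (insert 0 ((\<lambda>i. degree (B $$ (i,0))) ` {..<n})) + 1"
  have "w N = (\<lambda>_. 0)"
  proof
    fix i
    have "degree (B $$ (i,0)) < N" if "i < n"
      unfolding N_def using that by (simp add: less_Suc_eq_le trans_le_add2)
    then show "w N i = 0" by (simp add: w_def coeff_eq_0)
  qed
  moreover have "(?T ^^ m) (\<lambda>_. 0) = (\<lambda>_. 0)" for m
    by (induction m) (auto simp: apply_mat_def)
  ultimately have "(\<Sum>l\<le>N. coeff ch l * krylov n A l i) = 0"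
    using tele[where N = N and i = i] by (simp del: funpow.simps)
  moreover have "(\<Sum>l\<le>N. coeff ch l * krylov n A l i) = (\<Sum>l\<le>n. coeff ch l * krylov n A l i)"
    using degree_monic_char_poly[OF A]
    by (intro sum.mono_neutral_right) (auto simp: N_def ch_def coeff_eq_0)
  ultimately show ?thesis by (simp add: ch_def)
qed

lemma krylov_smult:
  assumes "A \<in> carrier_mat n n"
  shows "krylov n (s \<cdot>\<^sub>m A) j i = s ^ j * krylov n A j i"
proof (induction j arbitrary: i)
  case (Suc j)
  have "krylov n (s \<cdot>\<^sub>m A) (Suc j) i
      = (if i < n then \<Sum>k<n. s * A $$ (i,k) * (s ^ j * krylov n A j k) else 0)"
    using assms by (auto simp: krylov_Suc Suc intro!: sum.cong)
  also have "\<dots> = s ^ Suc j * krylov n A (Suc j) i"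
    by (auto simp: krylov_Suc sum_distrib_left algebra_simps)
  finally show ?case .
qed (simp add: krylov_0)

lemma det_krylov_mat_smult:
  assumes A: "A \<in> carrier_mat n n"
  shows "Determinant.det (krylov_mat n A) dvd Determinant.det (krylov_mat n (s \<cdot>\<^sub>m A))"
proof -
  have "krylov_mat n (s \<cdot>\<^sub>m A) = krylov_mat n A * mat_diag n (\<lambda>j. s ^ j)"
    using krylov_smult[OF A, of s]
    by (subst mat_diag_mult_right[of _ n]) (auto simp: krylov_mat_def)
  then have "Determinant.det (krylov_mat n (s \<cdot>\<^sub>m A))
    = Determinant.det (krylov_mat n A) * Determinant.det (mat_diag n (\<lambda>j. s ^ j))"
    by (simp add: det_mult[of _ n])
  then show ?thesis by simp
qed

text \<open>
  Column \<open>j\<close> of the Krylov matrix has degree \<open>j d\<close>; bounding this by \<open>n d\<close> for all columns is crude but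
  enough.
\<close>

lemma poly_on_lines_det_krylov:
  assumes G: "\<And>i j. i < n \<Longrightarrow> j < n \<Longrightarrow> poly_on_lines n d (G i j)"
  shows "poly_on_lines n (n * (n * d))
    (\<lambda>A. Determinant.det (krylov_mat n (mat n n (\<lambda>(i,j). G i j A))))"
proof -
  have kry: "poly_on_lines n (j * d) (\<lambda>A. krylov n (mat n n (\<lambda>(i,j). G i j A)) j i)" for i j
  proof (induction j arbitrary: i)
    case 0
    then show ?case by (simp add: krylov_0 poly_on_lines_const)
  next
    case (Suc j)
    show ?case
    proof (cases "i < n")
      case True
      have "poly_on_lines n (Suc j * d)
        (\<lambda>A. \<Sum>k<n. G i k A * krylov n (mat n n (\<lambda>(i,j). G i j A)) j k)"
        using True by (intro poly_on_lines_sum) (auto intro!: poly_on_lines_mult G Suc)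
      with True show ?thesis by (simp add: krylov_Suc)
    qed (simp add: krylov_Suc poly_on_lines_const)
  qed
  show ?thesis
    unfolding krylov_mat_def
    by (rule poly_on_lines_det) (rule poly_on_lines_mono[OF kry], simp)
qed

text \<open>
  A matrix of determinant \<open>1\<close> whose Krylov matrix is Pascal's triangle and has
  determinant \<open>1\<close> too. It is the base point at which the polynomial that detects noncyclic matrices
  does not vanish, whatever the prime.
\<close>

definition one_plus_shift :: "nat \<Rightarrow> int mat" where
  "one_plus_shift n = mat n n (\<lambda>(i,j). if i = j \<or> i = Suc j then 1 else 0)"

lemma det_one_plus_shift: "Determinant.det (one_plus_shift n) = 1"
proof -
  have "Determinant.det (one_plus_shift n) = prod_list (diag_mat (one_plus_shift n))"
    by (rule det_lower_triangular[of n]) (auto simp: one_plus_shift_def)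
  also have "\<dots> = 1" unfolding prod_list_diag_prod by (simp add: one_plus_shift_def)
  finally show ?thesis .
qed

lemma krylov_one_plus_shift:
  "i < n \<Longrightarrow> krylov n (one_plus_shift n) j i = int (j choose i)"
proof (induction j arbitrary: i)
  case 0
  then show ?case by (cases i) (simp_all add: krylov_0)
next
  case (Suc j)
  have "krylov n (one_plus_shift n) (Suc j) i
      = (\<Sum>k<n. (if k = i then int (j choose k) else 0) + (if i = Suc k then int (j choose k) else 0))"
    using Suc by (auto simp: krylov_Suc one_plus_shift_def intro!: sum.cong)
  also have "\<dots> = int (j choose i) + (\<Sum>k<n. if i = Suc k then int (j choose k) else 0)"
    using Suc.prems by (simp add: sum.distrib)
  also have "\<dots> = int (Suc j choose i)"
    using Suc.prems by (cases i) (auto simp: sum.delta)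
  finally show ?case .
qed

lemma det_krylov_one_plus_shift:
  "Determinant.det (krylov_mat n (one_plus_shift n)) = 1"
proof -
  let ?K = "krylov_mat n (one_plus_shift n)"
  have "Determinant.det ?K = prod_list (diag_mat ?K)"
    by (rule det_upper_triangular[of _ n])
      (auto simp: krylov_mat_def krylov_one_plus_shift)
  also have "\<dots> = 1"
    unfolding prod_list_diag_prod by (simp add: krylov_mat_def krylov_one_plus_shift)
  finally show ?thesis .
qed

section \<open>Zeros of polynomial functions on matrices modulo a prime\<close>

lemma Fp_mats_iff:
  "A \<in> Fp_mats n p \<longleftrightarrow>
     A \<in> carrier_mat n n \<and> (\<forall>i<n. \<forall>j<n. 0 \<le> A $$ (i,j) \<and> A $$ (i,j) < p)"
  unfolding Fp_mats_def by (fastforce simp: elements_mat_def)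

lemma card_Fp_mats:
  assumes p: "p > 0"
  shows "card (Fp_mats n p) = nat p ^ (n * n)"
proof -
  let ?I = "{..<n} \<times> {..<n}"
  let ?P = "PiE ?I (\<lambda>_. {0..<p})"
  have "bij_betw (\<lambda>A. restrict (($$) A) ?I) (Fp_mats n p) ?P"
    by (rule bij_betw_byWitness[where f' = "mat n n"])
       (auto simp: Fp_mats_iff PiE_iff extensional_def fun_eq_iff
         intro!: eq_matI split: if_splits)
  then have "card (Fp_mats n p) = card ?P" by (rule bij_betw_same_card)
  also have "\<dots> = nat p ^ (n * n)" by (simp add: card_PiE card_cartesian_product)
  finally show ?thesis .
qed

definition red_mat :: "nat \<Rightarrow> int \<Rightarrow> int mat \<Rightarrow> int mat" where
  "red_mat n p A = mat n n (\<lambda>ij. A $$ ij mod p)"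

lemma red_mat_Fp: "p > 0 \<Longrightarrow> red_mat n p A \<in> Fp_mats n p"
  by (auto simp: red_mat_def Fp_mats_iff)

lemma red_mat_carrier [simp]: "red_mat n p A \<in> carrier_mat n n"
  by (simp add: red_mat_def)

lemma cong_red_mat: "cong_mat n p (red_mat n p A) A"
  by (auto simp: red_mat_def cong_mat_def)

lemma cong_mat_sym: "cong_mat n p A B \<Longrightarrow> cong_mat n p B A"
  by (simp add: cong_mat_def)

lemma cong_mat_trans: "cong_mat n p A B \<Longrightarrow> cong_mat n p B C \<Longrightarrow> cong_mat n p A C"
  by (simp add: cong_mat_def)

lemma Fp_mats_eqI:
  assumes "A \<in> Fp_mats n p" "B \<in> Fp_mats n p" "cong_mat n p A B"
  shows "A = B"
  using assms by (intro eq_matI) (auto simp: Fp_mats_iff cong_mat_def)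

lemma det_cong_mat:
  assumes "A \<in> carrier_mat n n" "B \<in> carrier_mat n n" "cong_mat n p A B"
  shows "Determinant.det A mod p = Determinant.det B mod p"
  using poly_on_lines_cong[OF poly_on_lines_det_self assms] .

definition inv_mod :: "int \<Rightarrow> int \<Rightarrow> int" where
  "inv_mod p t = (SOME s. t * s mod p = 1)"

lemma inv_mod:
  assumes "prime p" "\<not> p dvd t"
  shows "t * inv_mod p t mod p = 1"
proof -
  have "algebraic_semidom_class.coprime t p" using assms prime_imp_coprime[of p t] by (simp add: algebraic_semidom_class.coprime_commute)
  then obtain u v where "u * t + v * p = 1" using bezout_int[of t p] by auto
  then have "t * u = 1 + p * (- v)" by (simp add: algebra_simps)
  then have "t * u mod p = 1" using prime_gt_1_int[OF assms(1)] by (simp only: mod_mult_self2) simp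
  then show ?thesis unfolding inv_mod_def by (rule someI)
qed

lemma not_dvd_of_range: "t \<in> {1..<p} \<Longrightarrow> \<not> p dvd (t::int)"
  using zdvd_not_zless by auto

text \<open>
  A form of the Schwartz-Zippel lemma. The line from \<open>X\<close> in a direction \<open>U\<close> carries at most \<open>d\<close> zeros,
  since \<open>F\<close> does not vanish at \<open>X\<close>. Conversely a zero \<open>A\<close> is reached at every parameter \<open>t \<noteq> 0\<close>, in the
  direction \<open>(A - X) / t\<close>. So the zeros, counted \<open>p - 1\<close> times each, number at most \<open>d\<close> per direction.
\<close>

lemma card_zeros_poly_on_lines:
  assumes p: "prime p" and F: "poly_on_lines n d F"
    and X: "X \<in> carrier_mat n n" "\<not> p dvd F X"
  shows "card {A \<in> Fp_mats n p. p dvd F A} * (nat p - 1) \<le> d * nat p ^ (n * n)"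
proof -
  have p1: "p > 1" using prime_gt_1_int[OF p] .
  let ?Z = "{A \<in> Fp_mats n p. p dvd F A}"
  let ?R = "\<lambda>U. {t \<in> {0..<p}. p dvd F (X + t \<cdot>\<^sub>m U)}"
  define dir where "dir = (\<lambda>(A,t). (red_mat n p (inv_mod p t \<cdot>\<^sub>m (A - X)), t))"
  have recover: "cong_mat n p (X + t \<cdot>\<^sub>m fst (dir (A,t))) A" if "A \<in> ?Z" "t \<in> {1..<p}" for A t
    unfolding cong_mat_def
  proof (intro allI impI)
    fix i j assume ij: "i < n" "j < n"
    have A: "A \<in> carrier_mat n n" using that by (simp add: Fp_mats_iff)
    define a x s where "a = A $$ (i,j)" and "x = X $$ (i,j)" and "s = inv_mod p t"
    have ts: "t * s mod p = 1" unfolding s_def by (rule inv_mod[OF p not_dvd_of_range[OF that(2)]])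
    have "(X + t \<cdot>\<^sub>m fst (dir (A,t))) $$ (i,j) mod p = (x + t * (s * (a - x) mod p)) mod p"
      using A X(1) ij by (simp add: dir_def red_mat_def a_def x_def s_def)
    also have "\<dots> = (x + t * s * (a - x)) mod p"
      unfolding mult.assoc by (metis mod_add_right_eq mod_mult_right_eq)
    also have "\<dots> = (x + (t * s mod p) * (a - x)) mod p"
      by (metis mod_add_right_eq mod_mult_left_eq)
    also have "\<dots> = a mod p" by (simp add: ts)
    finally show "(X + t \<cdot>\<^sub>m fst (dir (A,t))) $$ (i,j) mod p = A $$ (i,j) mod p"
      by (simp add: a_def)
  qed
  have inj: "inj_on dir (?Z \<times> {1..<p})"
  proof (rule inj_onI, clarify)
    fix A t B s
    assume A: "A \<in> Fp_mats n p" "p dvd F A" "t \<in> {1..<p}"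
      and B: "B \<in> Fp_mats n p" "p dvd F B" "s \<in> {1..<p}" and eq: "dir (A, t) = dir (B, s)"
    have ts: "t = s" using eq by (simp add: dir_def)
    have "cong_mat n p A B"
      using recover[of A t] recover[of B s] A B eq ts cong_mat_sym cong_mat_trans
      by (metis (no_types, lifting) mem_Collect_eq)
    then show "A = B \<and> t = s" using Fp_mats_eqI[OF A(1) B(1)] ts by simp
  qed
  have sub: "dir ` (?Z \<times> {1..<p}) \<subseteq> Sigma (Fp_mats n p) ?R"
  proof (rule image_subsetI)
    fix At assume "At \<in> ?Z \<times> {1..<p}"
    then obtain A t where At: "At = (A, t)" and A: "A \<in> ?Z" "t \<in> {1..<p}" by blast
    define U where "U = fst (dir (A, t))"
    have U: "U \<in> Fp_mats n p" using p1 by (simp add: U_def dir_def red_mat_Fp)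
    have "F (X + t \<cdot>\<^sub>m U) mod p = F A mod p"
      using recover[OF A] A X(1) U
      by (intro poly_on_lines_cong[OF F]) (auto simp: Fp_mats_iff U_def)
    then have "(U, t) \<in> Sigma (Fp_mats n p) ?R"
      using A U by (auto simp: dvd_eq_mod_eq_0)
    then show "dir At \<in> Sigma (Fp_mats n p) ?R" by (simp add: At U_def dir_def)
  qed
  have fibre: "card (?R U) \<le> d" if U: "U \<in> Fp_mats n p" for U
  proof -
    have Uc: "U \<in> carrier_mat n n" using U by (simp add: Fp_mats_iff)
    obtain q where q: "degree q \<le> d" "\<And>t. poly q t = F (X + t \<cdot>\<^sub>m U)"
      using F X(1) Uc unfolding poly_on_lines_def by blast
    have "X + 0 \<cdot>\<^sub>m U = X" using X(1) Uc by (intro eq_matI) auto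
    then have "\<not> p dvd poly q 0" using q(2)[of 0] X(2) by simp
    from card_roots_mod_prime[OF p this] show ?thesis using q by simp
  qed
  have fin: "finite (?R U)" for U by (rule finite_subset[of _ "{0..<p}"]) auto
  have "card ?Z * (nat p - 1) = card (?Z \<times> {1..<p})"
    using p1 by (simp add: card_cartesian_product nat_diff_distrib)
  also have "\<dots> = card (dir ` (?Z \<times> {1..<p}))" by (rule card_image[OF inj, symmetric])
  also have "\<dots> \<le> card (Sigma (Fp_mats n p) ?R)"
    by (intro card_mono finite_SigmaI finite_Fp_mats fin sub)
  also have "\<dots> = (\<Sum>U\<in>Fp_mats n p. card (?R U))"
    by (intro card_SigmaI finite_Fp_mats ballI fin)
  also have "\<dots> \<le> (\<Sum>U\<in>Fp_mats n p. d)" by (intro sum_mono fibre)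
  also have "\<dots> = d * nat p ^ (n * n)" using p1 by (simp add: card_Fp_mats)
  finally show ?thesis .
qed

section \<open>Counting in the special linear group\<close>

definition GL :: "nat \<Rightarrow> int \<Rightarrow> int mat set" where
  "GL n p = {A \<in> Fp_mats n p. \<not> p dvd Determinant.det A}"

text \<open>
  Scaling the last row by \<open>s\<close> multiplies the determinant by \<open>s\<close>. The determinant therefore recovers \<open>s\<close>,
  and scaling back recovers the matrix of determinant \<open>1\<close>. Through this bijection, counts in \<open>SL\<close> become
  counts in the affine space of all matrices.
\<close>

lemma SL_times_units:
  assumes p: "prime p" and n: "n > 0"
  shows "bij_betw (\<lambda>(A,s). red_mat n p (multrow (n - 1) s A)) (SL n p \<times> {1..<p}) (GL n p)"
proof -
  have p1: "p > 1" using prime_gt_1_int[OF p] .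
  define h where "h = (\<lambda>s A. red_mat n p (multrow (n - 1) s A))"
  have det_h: "Determinant.det (h s A) mod p = s * Determinant.det A mod p"
    if "A \<in> carrier_mat n n" for s A
  proof -
    have "Determinant.det (h s A) mod p = Determinant.det (multrow (n - 1) s A) mod p"
      unfolding h_def using that by (intro det_cong_mat[of _ n] cong_red_mat) auto
    then show ?thesis using that n by (subst (asm) det_multrow[of _ n]) auto
  qed
  have h_h: "h s (h t A) = A" if "A \<in> Fp_mats n p" "s * t mod p = 1" for s t A
  proof (rule Fp_mats_eqI)
    show "h s (h t A) \<in> Fp_mats n p" using p1 by (simp add: h_def red_mat_Fp)
    show "cong_mat n p (h s (h t A)) A"
      unfolding cong_mat_def
    proof (intro allI impI)
      fix i j assume ij: "i < n" "j < n"
      have "s * (t * x mod p) mod p = x mod p" for x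
      proof -
        have "s * (t * x mod p) mod p = (s * t mod p) * x mod p"
          by (simp add: mod_simps mult.assoc)
        then show ?thesis by (simp add: that)
      qed
      then show "h s (h t A) $$ (i,j) mod p = A $$ (i,j) mod p"
        using ij that(1) by (auto simp: h_def red_mat_def Fp_mats_iff)
    qed
  qed (use that in simp)
  define g where "g = (\<lambda>A. (h (inv_mod p (Determinant.det A mod p)) A, Determinant.det A mod p))"
  have inv: "a * inv_mod p a mod p = 1" "inv_mod p a * a mod p = 1" if "\<not> p dvd a" for a
    using inv_mod[OF p that] by (simp_all add: mult.commute)
  have "bij_betw (\<lambda>(A,s). h s A) (SL n p \<times> {1..<p}) (GL n p)"
  proof (rule bij_betw_byWitness[where f' = g])
    show "\<forall>a\<in>SL n p \<times> {1..<p}. g (case a of (A, s) \<Rightarrow> h s A) = a"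
    proof clarify
      fix A s assume A: "A \<in> SL n p" and s: "s \<in> {1..<p}"
      have AF: "A \<in> Fp_mats n p" "Determinant.det A mod p = 1" "A \<in> carrier_mat n n"
        using A p1 by (auto simp: SL_def Fp_mats_iff)
      have "Determinant.det (h s A) mod p = s * (Determinant.det A mod p) mod p"
        using det_h[OF AF(3)] by (simp add: mod_simps)
      also have "\<dots> = s" using s by (simp add: AF)
      finally have d: "Determinant.det (h s A) mod p = s" .
      show "g (h s A) = (A, s)"
        unfolding g_def d using h_h[OF AF(1) inv(2)[OF not_dvd_of_range[OF s]]] by simp
    qed
    show "\<forall>B\<in>GL n p. (case g B of (A, s) \<Rightarrow> h s A) = B"
    proof
      fix B assume "B \<in> GL n p"
      then have B: "B \<in> Fp_mats n p" "\<not> p dvd Determinant.det B mod p"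
        by (auto simp: GL_def dvd_mod_iff)
      show "(case g B of (A, s) \<Rightarrow> h s A) = B"
        using h_h[OF B(1) inv(1)[OF B(2)]] by (simp add: g_def)
    qed
    show "(\<lambda>(A,s). h s A) ` (SL n p \<times> {1..<p}) \<subseteq> GL n p"
    proof clarify
      fix A s assume A: "A \<in> SL n p" and s: "s \<in> {1..<p}"
      have AF: "Determinant.det A mod p = 1" "A \<in> carrier_mat n n"
        using A p1 by (auto simp: SL_def Fp_mats_iff)
      have "Determinant.det (h s A) mod p = s * (Determinant.det A mod p) mod p"
        using det_h[OF AF(2)] by (simp add: mod_simps)
      also have "\<dots> = s" using s by (simp add: AF)
      finally show "h s A \<in> GL n p"
        using s p1 by (auto simp: GL_def dvd_eq_mod_eq_0 h_def red_mat_Fp)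
    qed
    show "g ` GL n p \<subseteq> SL n p \<times> {1..<p}"
    proof (rule image_subsetI)
      fix B assume "B \<in> GL n p"
      then have B: "B \<in> Fp_mats n p" "\<not> p dvd Determinant.det B mod p" "B \<in> carrier_mat n n"
        by (auto simp: GL_def dvd_mod_iff Fp_mats_iff)
      define d where "d = Determinant.det B mod p"
      have d: "d \<in> {1..<p}"
        using B(2) p1 by (metis atLeastLessThan_iff d_def dvd_0_right int_one_le_iff_zero_less
            order_le_less pos_mod_bound pos_mod_sign zero_less_one order.strict_trans)
      have "Determinant.det (h (inv_mod p d) B) mod p = inv_mod p d * d mod p"
        using det_h[OF B(3), of "inv_mod p d"] by (simp add: d_def mod_simps)
      also have "\<dots> = 1" using inv(2)[of d] B(2) by (simp add: d_def)
      finally have "h (inv_mod p d) B \<in> SL n p"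
        using p1 by (simp add: SL_def h_def red_mat_Fp)
      with d show "g B \<in> SL n p \<times> {1..<p}" by (simp add: g_def d_def)
    qed
  qed
  then show ?thesis by (simp add: h_def)
qed

text \<open>
  The singular matrices are the zeros of the determinant, a polynomial of degree \<open>n\<close> that does not vanish
  at the identity. Up to a factor that tends to \<open>1\<close>, this says that \<open>SL\<close> has at least \<open>p\<close> to the power
  \<open>n\<^sup>2 - 1\<close> elements.
\<close>

lemma card_SL_lower:
  assumes p: "prime p" and n: "n > 0"
  shows "nat p ^ (n * n) * (nat p - 1) \<le> card (SL n p) * (nat p - 1) * (nat p - 1) + n * nat p ^ (n * n)"
proof -
  have p1: "p > 1" using prime_gt_1_int[OF p] .
  let ?Z = "{A \<in> Fp_mats n p. p dvd Determinant.det A}"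
  have Z: "card ?Z * (nat p - 1) \<le> n * nat p ^ (n * n)"
    using p1 by (intro card_zeros_poly_on_lines[OF p poly_on_lines_det_self, of "1\<^sub>m n"])
      (auto simp: zdvd1_eq)
  have "Fp_mats n p = GL n p \<union> ?Z" by (auto simp: GL_def)
  then have "nat p ^ (n * n) \<le> card (GL n p) + card ?Z"
    using card_Fp_mats[of p n] card_Un_le[of "GL n p" ?Z] p1 by simp
  also have "card (GL n p) = card (SL n p) * (nat p - 1)"
    using bij_betw_same_card[OF SL_times_units[OF p n]] p1
    by (simp add: card_cartesian_product nat_diff_distrib)
  finally have "nat p ^ (n * n) * (nat p - 1)
      \<le> (card (SL n p) * (nat p - 1) + card ?Z) * (nat p - 1)"
    by (rule mult_le_mono1)
  then show ?thesis using Z by (simp add: distrib_right)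
qed

text \<open>
  The vector \<open>e\<^sub>0\<close> fails to be cyclic for \<open>A\<close> exactly when the determinant of the Krylov matrix vanishes
  modulo \<open>p\<close>, a polynomial condition. To count its solutions inside \<open>SL\<close>, the condition is carried over to
  all matrices. If \<open>N\<close> arises from \<open>A\<close> in \<open>SL\<close> by scaling the last row by \<open>s\<close>, then \<open>s = det N\<close>, and
  multiplying all other rows of \<open>N\<close> by \<open>det N\<close> yields \<open>s A\<close>. This undoes the scaling up to a scalar, without any
  division, so it is polynomial in \<open>N\<close>; and \<open>e\<^sub>0\<close> is cyclic for \<open>s A\<close> if and only if it is for \<open>A\<close>.
\<close>

lemma card_SL_noncyclic:
  assumes p: "prime p" and n: "n > 0"
  shows "card {A \<in> SL n p. p dvd Determinant.det (krylov_mat n A)} * (nat p - 1) * (nat p - 1)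
    \<le> n * (n * (n + 1)) * nat p ^ (n * n)"
proof -
  have p1: "p > 1" using prime_gt_1_int[OF p] .
  define G where "G = (\<lambda>i j (N :: int mat). (if i = n - 1 then 1 else Determinant.det N) * N $$ (i,j))"
  \<comment> \<open>\<open>B N\<close> is \<open>N\<close> with all rows but the last multiplied by \<open>det N\<close>.\<close>
  define B where "B = (\<lambda>N. mat n n (\<lambda>(i,j). G i j N))"
  define F where "F = (\<lambda>N. Determinant.det (krylov_mat n (B N)))"
  have "poly_on_lines n (n + 1) (G i j)" if "i < n" "j < n" for i j
    unfolding G_def using that
    by (cases "i = n - 1")
      (auto intro!: poly_on_lines_mult[of n n _ 1, simplified] poly_on_lines_const
        poly_on_lines_entry poly_on_lines_det_self
        poly_on_lines_mono[OF poly_on_lines_entry])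
  then have F: "poly_on_lines n (n * (n * (n + 1))) F"
    unfolding F_def B_def by (rule poly_on_lines_det_krylov)
  let ?X = "one_plus_shift n"
  have X: "?X \<in> carrier_mat n n" by (simp add: one_plus_shift_def)
  have "B ?X = ?X"
    using X by (intro eq_matI) (auto simp: B_def G_def det_one_plus_shift)
  then have "F ?X = 1" by (simp add: F_def det_krylov_one_plus_shift)
  then have Z: "card {A \<in> Fp_mats n p. p dvd F A} * (nat p - 1)
      \<le> n * (n * (n + 1)) * nat p ^ (n * n)"
    using p1 by (intro card_zeros_poly_on_lines[OF p F X]) (auto simp: zdvd1_eq)
  let ?N = "{A \<in> SL n p. p dvd Determinant.det (krylov_mat n A)}"
  let ?h = "\<lambda>(A,s). red_mat n p (multrow (n - 1) s A)"
  have sub: "?h ` (?N \<times> {1..<p}) \<subseteq> {A \<in> Fp_mats n p. p dvd F A}"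
  proof (rule image_subsetI)
    fix As assume "As \<in> ?N \<times> {1..<p}"
    then obtain A s where As: "As = (A, s)"
      and A: "A \<in> SL n p" "p dvd Determinant.det (krylov_mat n A)" "s \<in> {1..<p}" by blast
    have Ac: "A \<in> carrier_mat n n" and dA: "Determinant.det A mod p = 1"
      using A p1 by (auto simp: SL_def Fp_mats_iff)
    define M where "M = multrow (n - 1) s A"
    have M: "M \<in> carrier_mat n n" using Ac by (simp add: M_def)
    have dM: "Determinant.det M = s * Determinant.det A"
      using n Ac by (simp add: M_def det_multrow[of _ n])
    have "cong_mat n p (B M) (s \<cdot>\<^sub>m A)"
      unfolding cong_mat_def
    proof (intro allI impI)
      fix i j assume ij: "i < n" "j < n"
      have "s * Determinant.det A * a mod p = s * a mod p" for a
      proof -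
        have "s * Determinant.det A * a mod p = (Determinant.det A mod p) * (s * a) mod p"
          unfolding mod_mult_left_eq by (simp add: ac_simps)
        then show ?thesis by (simp add: dA)
      qed
      then show "B M $$ (i,j) mod p = (s \<cdot>\<^sub>m A) $$ (i,j) mod p"
        using ij Ac by (auto simp: B_def G_def dM) (auto simp: M_def)
    qed
    moreover have "poly_on_lines n (n * n) (\<lambda>A. Determinant.det (krylov_mat n A))"
    proof (rule poly_on_lines_cong_carrier)
      show "poly_on_lines n (n * n)
        (\<lambda>A. Determinant.det (krylov_mat n (mat n n (\<lambda>(i,j). A $$ (i,j)))))"
        using poly_on_lines_det_krylov[of n 1 "\<lambda>i j A. A $$ (i,j)"] poly_on_lines_entry by simp
    qed (simp only: mat_entries)
    ultimately have "F M mod p = Determinant.det (krylov_mat n (s \<cdot>\<^sub>m A)) mod p"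
      unfolding F_def using Ac
      by (intro poly_on_lines_cong[where F = "\<lambda>A. Determinant.det (krylov_mat n A)"])
        (auto simp: B_def)
    moreover have "F (red_mat n p M) mod p = F M mod p"
      by (rule poly_on_lines_cong[OF F _ M cong_red_mat]) simp
    moreover have "p dvd Determinant.det (krylov_mat n (s \<cdot>\<^sub>m A))"
      using A(2) det_krylov_mat_smult[OF Ac] dvd_trans by blast
    ultimately show "?h As \<in> {A \<in> Fp_mats n p. p dvd F A}"
      using p1 by (simp add: As red_mat_Fp M_def dvd_eq_mod_eq_0)
  qed
  have "inj_on ?h (?N \<times> {1..<p})"
    using SL_times_units[OF p n] by (auto simp: bij_betw_def intro: inj_on_subset)
  then have "card (?N \<times> {1..<p}) \<le> card {A \<in> Fp_mats n p. p dvd F A}"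
    using card_inj_on_le[OF _ sub] finite_Fp_mats by simp
  then have "card ?N * (nat p - 1) \<le> card {A \<in> Fp_mats n p. p dvd F A}"
    using p1 by (simp add: card_cartesian_product nat_diff_distrib)
  from mult_le_mono1[OF this] Z show ?thesis by (rule le_trans)
qed

section \<open>Cyclic matrices with a given characteristic polynomial\<close>

lemma coeff_char_poly_0:
  fixes A :: "'a::comm_ring_1 mat"
  assumes A: "A \<in> carrier_mat n n"
  shows "coeff (char_poly A) 0 = (-1) ^ n * Determinant.det A"
proof -
  have "poly (char_poly A) 0 = Determinant.det ((-1) \<cdot>\<^sub>m A)"
    unfolding char_poly_def using A
    by (intro poly_det_cong[of _ n]) (auto simp: char_poly_matrix_def)
  then show ?thesis using A by (simp add: poly_0_coeff_0)
qed

text \<open>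
  The vector \<open>A\<^sup>n e\<^sub>0\<close> is not a column of the Krylov matrix; the Cayley-Hamilton theorem expresses it by
  these columns and the characteristic polynomial.
\<close>

lemma krylov_n_cong:
  assumes A: "A \<in> carrier_mat n n" and B: "B \<in> carrier_mat n n" and n: "n > 0"
    and k: "\<And>i j. i < n \<Longrightarrow> j < n \<Longrightarrow> p dvd krylov n A j i - krylov n B j i"
    and ch: "Fp_char_poly p A = Fp_char_poly p B"
    and i: "i < n"
  shows "p dvd krylov n A n i - krylov n B n i"
proof -
  have last: "krylov n X n i = - (\<Sum>l<n. coeff (char_poly X) l * krylov n X l i)"
    if X: "X \<in> carrier_mat n n" for X :: "int mat"
  proof -
    have "{..n} = insert n {..<n}" by auto
    then show ?thesis
      using cayley_hamilton_krylov[OF X n, of i] degree_monic_char_poly[OF X]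
      by (simp add: add_eq_0_iff2)
  qed
  have c: "p dvd coeff (char_poly A) l - coeff (char_poly B) l" for l
    using arg_cong[OF ch, of "\<lambda>f. coeff f l"]
    by (simp add: Fp_char_poly_def poly_mod.Mp_coeff poly_mod.M_def mod_eq_dvd_iff)
  have "krylov n A n i - krylov n B n i = (\<Sum>l<n. coeff (char_poly B) l * krylov n B l i
      - coeff (char_poly A) l * krylov n A l i)"
    by (simp add: last[OF A] last[OF B] sum_subtractf)
  also have "p dvd \<dots>"
  proof (rule dvd_sum)
    fix l assume "l \<in> {..<n}"
    then have kl: "p dvd krylov n A l i - krylov n B l i" using k i by simp
    have "coeff (char_poly B) l * krylov n B l i - coeff (char_poly A) l * krylov n A l i
      = - ((coeff (char_poly A) l - coeff (char_poly B) l) * krylov n A l i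
         + coeff (char_poly B) l * (krylov n A l i - krylov n B l i))"
      by (simp add: algebra_simps)
    also have "p dvd \<dots>" using c[of l] kl by (simp only: dvd_minus_iff dvd_add dvd_mult dvd_mult2)
    finally show "p dvd coeff (char_poly B) l * krylov n B l i
      - coeff (char_poly A) l * krylov n A l i" .
  qed
  finally show ?thesis .
qed

text \<open>
  If \<open>e\<^sub>0\<close> is cyclic for \<open>A\<close>, then \<open>e\<^sub>0, A e\<^sub>0, \<dots>, A\<^bsup>n-1\<^esup> e\<^sub>0\<close> is a basis, and \<open>A\<close> is determined by its
  values on it. These values are the next vectors of the sequence. In terms of matrices, \<open>(A - B) K\<close> is zero
  modulo \<open>p\<close> for the Krylov matrix \<open>K\<close>, and multiplying by the adjugate of \<open>K\<close> cancels \<open>K\<close>.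
\<close>

lemma Fp_mats_eq_if_krylov_char_poly_eq:
  assumes p: "prime p" and n: "n > 0" and A: "A \<in> Fp_mats n p" and B: "B \<in> Fp_mats n p"
    and cyc: "\<not> p dvd Determinant.det (krylov_mat n A)"
    and k: "\<And>i j. i < n \<Longrightarrow> j < n \<Longrightarrow> p dvd krylov n A j i - krylov n B j i"
    and ch: "Fp_char_poly p A = Fp_char_poly p B"
  shows "A = B"
proof (rule Fp_mats_eqI[OF A B])
  have Ac: "A \<in> carrier_mat n n" and Bc: "B \<in> carrier_mat n n"
    using A B by (simp_all add: Fp_mats_iff)
  let ?K = "krylov_mat n A"
  define X where "X = A - B"
  have X: "X \<in> carrier_mat n n" unfolding X_def using Bc by (rule minus_carrier_mat)
  have k': "p dvd krylov n A (Suc j) i - krylov n B (Suc j) i" if "i < n" "j < n" for i j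
    using that krylov_n_cong[OF Ac Bc n k ch] k by (cases "Suc j = n") auto
  have XK: "p dvd (X * ?K) $$ (i,j)" if ij: "i < n" "j < n" for i j
  proof -
    have "(X * ?K) $$ (i,j) = (\<Sum>k<n. (A $$ (i,k) - B $$ (i,k)) * krylov n A j k)"
      using ij Ac Bc
      by (simp add: X_def scalar_prod_def krylov_mat_def atLeast0LessThan)
    also have "\<dots> = (krylov n A (Suc j) i - krylov n B (Suc j) i)
        - (\<Sum>k<n. B $$ (i,k) * (krylov n A j k - krylov n B j k))"
      using ij by (simp add: krylov_Suc algebra_simps sum_subtractf)
    also have "p dvd \<dots>"
      using ij by (intro dvd_diff k' dvd_sum) (auto intro: dvd_mult k)
    finally show ?thesis .
  qed
  show "cong_mat n p A B"
    unfolding cong_mat_def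
  proof (intro allI impI)
    fix i j assume ij: "i < n" "j < n"
    note adj = adj_mat[OF krylov_mat_carrier[of n A]]
    have "X * ?K * adj_mat ?K = X * (?K * adj_mat ?K)"
      using X adj(1) by (intro assoc_mult_mat[of _ n n _ n _ n]) auto
    also have "\<dots> = Determinant.det ?K \<cdot>\<^sub>m X"
      using X by (simp add: adj(2) mult_smult_distrib[of _ n n _ n])
    finally have "Determinant.det ?K * X $$ (i,j) = (X * ?K * adj_mat ?K) $$ (i,j)"
      using X ij by simp
    also have "\<dots> = (\<Sum>l<n. (X * ?K) $$ (i,l) * adj_mat ?K $$ (l,j))"
    proof -
      have "dim_row (adj_mat ?K) = n" "dim_col (adj_mat ?K) = n" "dim_row X = n" "dim_col ?K = n"
        using adj(1) X by (auto simp: krylov_mat_def)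
      then show ?thesis
        using ij by (subst index_mult_mat(1)) (auto simp: scalar_prod_def atLeast0LessThan intro!: sum.cong)
    qed
    also have "p dvd \<dots>" using ij by (intro dvd_sum dvd_mult2 XK) auto
    finally have "p dvd X $$ (i,j)" using cyc p by (simp add: prime_dvd_mult_iff)
    then show "A $$ (i,j) mod p = B $$ (i,j) mod p"
      using ij Ac Bc by (simp add: X_def mod_eq_dvd_iff)
  qed
qed

section \<open>Characteristic polynomials with a factor of constant term one\<close>

definition monic_Fp_polys :: "int \<Rightarrow> nat \<Rightarrow> int \<Rightarrow> int poly set" where
  "monic_Fp_polys p m c = {f \<in> Fp_polys p. monic f \<and> degree f = m \<and> coeff f 0 = c}"

lemma card_monic_Fp_polys:
  assumes p: "p > 0" and m: "m > 0"
  shows "finite (monic_Fp_polys p m c)" "card (monic_Fp_polys p m c) \<le> nat p ^ (m - 1)"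
proof -
  let ?g = "\<lambda>f :: int poly. restrict (coeff f) {1..<m}"
  let ?P = "PiE {1..<m} (\<lambda>_. {0..<p})"
  have inj: "inj_on ?g (monic_Fp_polys p m c)"
  proof (rule inj_onI)
    fix f h assume f: "f \<in> monic_Fp_polys p m c" and h: "h \<in> monic_Fp_polys p m c"
      and eq: "?g f = ?g h"
    show "f = h"
    proof (rule poly_eqI)
      fix i
      consider "i = 0" | "i \<in> {1..<m}" | "i = m" | "i > m" by force
      then show "coeff f i = coeff h i"
      proof cases
        case 2
        then show ?thesis using fun_cong[OF eq, of i] by simp
      qed (use f h in \<open>auto simp: monic_Fp_polys_def coeff_eq_0\<close>)
    qed
  qed
  have sub: "?g ` monic_Fp_polys p m c \<subseteq> ?P"
    by (fastforce simp: monic_Fp_polys_def Fp_polys_def)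
  have fin: "finite ?P" by (simp add: finite_PiE)
  show "finite (monic_Fp_polys p m c)" by (rule inj_on_finite[OF inj sub fin])
  have "card (monic_Fp_polys p m c) \<le> card ?P" by (rule card_inj_on_le[OF inj sub fin])
  then show "card (monic_Fp_polys p m c) \<le> nat p ^ (m - 1)" by (simp add: card_PiE)
qed

text \<open>
  The cofactor is normalised by reducing it modulo \<open>p\<close>. Since \<open>f\<close> is monic, the leading coefficient of
  \<open>f h\<close> is then that of \<open>h\<close>, which is nonzero modulo \<open>p\<close>, so no degree is lost in reducing \<open>f h\<close>.
\<close>

lemma monic_factorization_mod:
  assumes p: "p > 1" and f: "f \<in> monic_Fp_polys p m 1"
    and g: "monic g" "degree g = n"
    and dvd: "poly_mod.dvdm p f g"
  shows "\<exists>h \<in> monic_Fp_polys p (n - m) (coeff g 0 mod p). poly_mod.Mp p g = poly_mod.Mp p (f * h)"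
proof -
  interpret poly_mod p .
  have f': "monic f" "degree f = m" "coeff f 0 = 1" using f by (auto simp: monic_Fp_polys_def)
  obtain h where gh: "Mp g = Mp (f * h)" and h: "Mp h = h" using dvd by (rule dvdmE)
  have hc: "coeff h i mod p = coeff h i" for i
    using arg_cong[OF h, of "\<lambda>f. coeff f i"] by (simp add: Mp_coeff M_def)
  have dg: "degree (Mp g) = n" "coeff (Mp g) n = 1"
    using g p degree_m_eq[of g] by (auto simp: Mp_coeff M_def)
  have "coeff h i \<in> {0..<p}" for i
    using pos_mod_bound[of p "coeff h i"] pos_mod_sign[of p "coeff h i"] p by (simp add: hc)
  then have hF: "h \<in> Fp_polys p" by (auto simp: Fp_polys_def)
  have h0: "h \<noteq> 0"
  proof
    assume "h = 0"
    then have "coeff (Mp g) n = 0" using gh by simp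
    then show False using dg by simp
  qed
  have f0: "f \<noteq> 0" using f' by auto
  have lc: "coeff (f * h) (degree (f * h)) = coeff h (degree h)"
    using f' by (simp add: lead_coeff_mult)
  have "degree (Mp (f * h)) = degree (f * h)"
    using p h0 by (intro degree_m_eq) (simp_all add: lc hc)
  then have dh: "degree (f * h) = n" using gh dg by simp
  then have deg: "degree h = n - m"
    using degree_mult_eq[OF f0 h0] f' by simp
  have "coeff h (degree h) = coeff (Mp (f * h)) n"
    using lc dh hc by (simp add: Mp_coeff M_def)
  then have "monic h" using gh dg by simp
  moreover have "coeff h 0 = coeff g 0 mod p"
    using arg_cong[OF gh, of "\<lambda>f. coeff f 0"] f' hc[of 0]
    by (simp add: Mp_coeff M_def coeff_mult_0)
  ultimately show ?thesis using deg gh hF by (intro bexI[of _ h]) (auto simp: monic_Fp_polys_def)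
qed

text \<open>
  Such a characteristic polynomial is \<open>f h\<close> with \<open>f\<close> monic of degree \<open>m\<close> and \<open>h\<close> monic of degree \<open>n - m\<close>.
  Both constant terms are prescribed, that of \<open>h\<close> because \<open>det A = 1\<close>. This leaves \<open>m - 1\<close> free coefficients
  in \<open>f\<close> and \<open>n - m - 1\<close> in \<open>h\<close>, altogether \<open>n - 2\<close>, one less than for a general characteristic
  polynomial of a matrix in \<open>SL\<close>.
\<close>

lemma card_char_polys_with_factor:
  assumes p: "prime p" and n: "n \<ge> 2"
  defines "S \<equiv> {A \<in> SL n p. has_proper_factor_const_one n p (Fp_char_poly p A)}"
  shows "card (Fp_char_poly p ` S) \<le> n * nat p ^ (n - 2)"
proof -
  have p1: "p > 1" using prime_gt_1_int[OF p] .
  let ?c = "(-1) ^ n mod p"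
  let ?Q = "\<lambda>m. monic_Fp_polys p m 1 \<times> monic_Fp_polys p (n - m) ?c"
  let ?f = "\<lambda>(f,h). poly_mod.Mp p (f * h)"
  have "Fp_char_poly p ` S \<subseteq> (\<Union>m\<in>{1..n-1}. ?f ` ?Q m)"
  proof (rule image_subsetI)
    fix A assume "A \<in> S"
    then have A: "A \<in> carrier_mat n n" "Determinant.det A mod p = 1"
      and bad: "has_proper_factor_const_one n p (Fp_char_poly p A)"
      using p1 by (auto simp: S_def SL_def Fp_mats_iff)
    then obtain f where f: "f \<in> Fp_polys p" "monic f" "1 \<le> degree f" "degree f \<le> n - 1"
      "coeff f 0 = 1" "poly_mod.dvdm p f (char_poly A)"
      by (auto simp: has_proper_factor_const_one_def Fp_char_poly_def poly_mod.dvdm_Mp)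
    have fm: "f \<in> monic_Fp_polys p (degree f) 1" using f by (simp add: monic_Fp_polys_def)
    from monic_factorization_mod[OF p1 fm _ _ f(6)] degree_monic_char_poly[OF A(1)]
    obtain h where h: "h \<in> monic_Fp_polys p (n - degree f) (coeff (char_poly A) 0 mod p)"
      and ch: "poly_mod.Mp p (char_poly A) = poly_mod.Mp p (f * h)" by auto
    have "coeff (char_poly A) 0 mod p = (-1) ^ n * (Determinant.det A mod p) mod p"
      by (simp add: coeff_char_poly_0[OF A(1)] mod_mult_right_eq)
    also have "\<dots> = ?c" by (simp add: A(2))
    finally have "(f, h) \<in> ?Q (degree f)" using fm h by simp
    moreover have "Fp_char_poly p A = ?f (f, h)" using ch by (simp add: Fp_char_poly_def)
    ultimately have "Fp_char_poly p A \<in> ?f ` ?Q (degree f)" by (rule rev_image_eqI)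
    then show "Fp_char_poly p A \<in> (\<Union>m\<in>{1..n-1}. ?f ` ?Q m)"
      using f(3,4) by (intro UN_I[of "degree f"]) simp_all
  qed
  moreover have finQ: "finite (?Q m)" if "m \<in> {1..n-1}" for m
    using that p1 n by (intro finite_cartesian_product card_monic_Fp_polys(1)) auto
  ultimately have "card (Fp_char_poly p ` S) \<le> card (\<Union>m\<in>{1..n-1}. ?f ` ?Q m)"
    by (intro card_mono) auto
  also have "\<dots> \<le> (\<Sum>m\<in>{1..n-1}. card (?f ` ?Q m))" by (rule card_UN_le) simp
  also have "\<dots> \<le> (\<Sum>m\<in>{1..n-1}. nat p ^ (n - 2))"
  proof (rule sum_mono)
    fix m assume m: "m \<in> {1..n-1}"
    have "card (?f ` ?Q m) \<le> card (?Q m)" by (rule card_image_le[OF finQ[OF m]])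
    also have "\<dots> \<le> nat p ^ (m - 1) * nat p ^ (n - m - 1)"
      unfolding card_cartesian_product using m p1 n
      by (intro mult_le_mono card_monic_Fp_polys(2)) auto
    also have "\<dots> = nat p ^ (n - 2)"
    proof -
      have "m - 1 + (n - m - 1) = n - 2" using m n by auto
      then show ?thesis by (simp add: power_add[symmetric])
    qed
    finally show "card (?f ` ?Q m) \<le> nat p ^ (n - 2)" .
  qed
  also have "\<dots> \<le> n * nat p ^ (n - 2)" by simp
  finally show ?thesis .
qed

text \<open>
  A matrix for which \<open>e\<^sub>0\<close> is cyclic is encoded by its characteristic polynomial and the last \<open>n - 1\<close>
  columns of its Krylov matrix; the first column is always \<open>e\<^sub>0\<close>.
\<close>

lemma card_SL_cyclic_with_factor:
  assumes p: "prime p" and n: "n \<ge> 2"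
  shows "card {A \<in> SL n p. has_proper_factor_const_one n p (Fp_char_poly p A)
            \<and> \<not> p dvd Determinant.det (krylov_mat n A)} * (nat p * nat p)
    \<le> n * nat p ^ (n * n)" (is "card ?S * _ \<le> _")
proof -
  have p1: "p > 1" using prime_gt_1_int[OF p] .
  let ?I = "{..<n} \<times> {1..<n}"
  let ?P = "PiE ?I (\<lambda>_. {0..<p})"
  let ?S' = "{A \<in> SL n p. has_proper_factor_const_one n p (Fp_char_poly p A)}"
  define g where "g = (\<lambda>A. (Fp_char_poly p A, restrict (\<lambda>(i,j). krylov n A j i mod p) ?I))"
  have inj: "inj_on g ?S"
  proof (rule inj_onI)
    fix A B assume A: "A \<in> ?S" and B: "B \<in> ?S" and eq: "g A = g B"
    have "n > 0" "A \<in> Fp_mats n p" "B \<in> Fp_mats n p"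
      "\<not> p dvd Determinant.det (krylov_mat n A)"
      using A B n by (simp_all add: SL_def)
    then show "A = B"
    proof (rule Fp_mats_eq_if_krylov_char_poly_eq[OF p])
      show "Fp_char_poly p A = Fp_char_poly p B"
        using arg_cong[OF eq, of fst] by (simp add: g_def)
      fix i j assume ij: "i < n" "j < n"
      show "p dvd krylov n A j i - krylov n B j i"
      proof (cases "j = 0")
        case False
        have "snd (g A) (i,j) = snd (g B) (i,j)" by (simp add: eq)
        then show ?thesis using ij False by (simp add: g_def mod_eq_dvd_iff)
      qed (simp add: krylov_0)
    qed
  qed
  have fin: "finite (Fp_char_poly p ` ?S')" using finite_SL[of n p] by simp
  have finP: "finite ?P" by (simp add: finite_PiE)
  have sub: "g ` ?S \<subseteq> (Fp_char_poly p ` ?S') \<times> ?P"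
  proof (rule image_subsetI)
    fix A assume "A \<in> ?S"
    then have "Fp_char_poly p A \<in> Fp_char_poly p ` ?S'" by blast
    moreover have "restrict (\<lambda>(i,j). krylov n A j i mod p) ?I \<in> ?P"
      using p1 by (intro restrict_PiE_iff[THEN iffD2]) auto
    ultimately show "g A \<in> (Fp_char_poly p ` ?S') \<times> ?P" by (simp only: g_def mem_Times_iff fst_conv snd_conv)
  qed
  have "card ?S \<le> card ((Fp_char_poly p ` ?S') \<times> ?P)"
    by (rule card_inj_on_le[OF inj sub]) (simp only: finite_cartesian_product fin finP)
  also have "\<dots> = card (Fp_char_poly p ` ?S') * nat p ^ (n * (n - 1))"
    by (simp add: card_cartesian_product card_PiE)
  also have "\<dots> \<le> n * nat p ^ (n - 2) * nat p ^ (n * (n - 1))"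
    by (rule mult_le_mono1) (rule card_char_polys_with_factor[OF p n])
  finally have "card ?S * (nat p * nat p)
      \<le> n * nat p ^ (n - 2) * nat p ^ (n * (n - 1)) * (nat p * nat p)"
    by (rule mult_le_mono1)
  also have "\<dots> = n * nat p ^ (n - 2 + n * (n - 1) + 2)"
    by (simp only: power_add power2_eq_square mult.assoc)
  also have "n - 2 + n * (n - 1) + 2 = n * n"
    using n by (cases n) auto
  finally show ?thesis .
qed

section \<open>The probability bound\<close>

theorem lemma5p1:
  fixes n :: nat
  assumes "n \<ge> 2"
  shows "\<exists>C :: real. \<forall>p :: int. prime p \<longrightarrow>
    measure_pmf.prob (pmf_of_set (SL n p))
      {A. has_proper_factor_const_one n p (Fp_char_poly p A)} \<le> C * (1 / real_of_int p)"
proof -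
  define D where "D = real (n * (n * (n + 1)))"
  define C where "C = 8 * D + 2 * real n + (2 * real n + 2)"
  have n0: "n > 0" using assms by simp
  have D0: "D \<ge> 0" by (simp add: D_def)
  show ?thesis
  proof (intro exI[of _ C] allI impI)
    fix p :: int assume p: "prime p"
    have p1: "p > 1" using prime_gt_1_int[OF p] .
    let ?prob = "measure_pmf.prob (pmf_of_set (SL n p))
      {A. has_proper_factor_const_one n p (Fp_char_poly p A)}"
    let ?bad = "{A \<in> SL n p. has_proper_factor_const_one n p (Fp_char_poly p A)}"
    let ?N = "{A \<in> SL n p. p dvd Determinant.det (krylov_mat n A)}"
    let ?Y = "{A \<in> SL n p. has_proper_factor_const_one n p (Fp_char_poly p A)
            \<and> \<not> p dvd Determinant.det (krylov_mat n A)}"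
    \<comment> \<open>For \<open>p\<close> at least \<open>2 n + 2\<close> both \<open>p - 1\<close> and \<open>p - 1 - n\<close> are at least \<open>p / 2\<close>; for smaller \<open>p\<close>
      the trivial bound \<open>1\<close> suffices, because \<open>C\<close> is at least \<open>2 n + 2\<close>.\<close>
    show "?prob \<le> C * (1 / real_of_int p)"
    proof (cases "p < 2 * int n + 2")
      case True
      have "?prob \<le> 1" by simp
      also have "1 \<le> C / real_of_int p"
      proof -
        have "real_of_int p \<le> 2 * real n + 2" using True by linarith
        also have "\<dots> \<le> C" using D0 by (simp add: C_def)
        finally show ?thesis using p1 by simp
      qed
      finally show ?thesis by simp
    next
      case False
      define q where "q = real (nat p)"
      define P where "P = q ^ (n * n)"
      define s where "s = real (card (SL n p))"
      define a where "a = real (card ?N)"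
      define b where "b = real (card ?Y)"
      have q: "q \<ge> 2 * real n + 2" "q = real_of_int p"
        using False p1 by (simp_all add: q_def)
      have q1: "real (nat p - 1) = real (nat p) - 1" using p1 by (simp add: of_nat_diff)
      have P0: "P > 0" using q by (simp add: P_def)
      have s0: "s > 0"
        using finite_SL[of n p] SL_nonempty[OF p1, of n] by (simp add: s_def card_gt_0_iff)
      have "P * (q - 1) \<le> s * (q - 1) * (q - 1) + real n * P"
        using card_SL_lower[OF p n0, THEN of_nat_mono[where 'a = real]]
        by (simp only: of_nat_mult of_nat_add of_nat_power q1 P_def s_def q_def)
      then have "P * (q - 1 - real n) \<le> s * ((q - 1) * (q - 1))" by (simp add: algebra_simps)
      moreover have "P * (q / 2) \<le> P * (q - 1 - real n)"
        using P0 q by (intro mult_left_mono) auto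
      moreover have "s * ((q - 1) * (q - 1)) \<le> s * (q * q)"
        using s0 q by (intro mult_left_mono mult_mono) auto
      ultimately have "q * P \<le> q * (2 * s * q)" by (simp add: algebra_simps)
      then have Ps: "P \<le> 2 * s * q" using q by (simp add: mult_le_cancel_left_pos)
      have "a * (q - 1) * (q - 1) \<le> D * P"
        using card_SL_noncyclic[OF p n0, THEN of_nat_mono[where 'a = real]]
        by (simp only: of_nat_mult of_nat_power q1 P_def a_def q_def D_def)
      moreover have "a * ((q / 2) * (q / 2)) \<le> a * ((q - 1) * (q - 1))"
        using q by (intro mult_left_mono mult_mono) (auto simp: a_def)
      ultimately have a: "a * (q * q) \<le> 4 * D * P" by (simp add: algebra_simps)
      have b: "b * (q * q) \<le> real n * P"
        using card_SL_cyclic_with_factor[OF p assms, THEN of_nat_mono[where 'a = real]]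
        by (simp only: of_nat_mult of_nat_power b_def P_def q_def)
      have "?bad \<subseteq> ?N \<union> ?Y" by auto
      then have "card ?bad \<le> card (?N \<union> ?Y)" using finite_SL[of n p] by (intro card_mono) auto
      also have "\<dots> \<le> card ?N + card ?Y" by (rule card_Un_le)
      finally have ab: "real (card ?bad) \<le> a + b" by (simp add: a_def b_def)
      have "(a + b) * q * q \<le> (4 * D + real n) * P" using a b by (simp add: algebra_simps)
      also have "\<dots> \<le> (4 * D + real n) * (2 * s * q)"
        using Ps D0 by (intro mult_left_mono) auto
      finally have "q * ((a + b) * q) \<le> q * ((8 * D + 2 * real n) * s)"
        by (simp add: algebra_simps)
      then have "(a + b) * q \<le> (8 * D + 2 * real n) * s" using q by (simp add: mult_le_cancel_left_pos)
      also have "\<dots> \<le> C * s" using s0 by (simp add: C_def)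
      finally have "(a + b) / s \<le> C / q" using s0 q by (simp add: field_simps)
      moreover have "?prob = real (card ?bad) / s"
        using measure_pmf_of_set[OF SL_nonempty[OF p1] finite_SL]
        by (simp add: s_def Int_def)
      moreover have "real (card ?bad) / s \<le> (a + b) / s" using ab s0 by (simp add: divide_right_mono)
      ultimately show ?thesis using q by simp
    qed
  qed
qed

end
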